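(* Let $G$ be a second countable unimodular locally compact group, let $\tau:G\to G$ be a continuous map, let $(\mathcal A,\gamma)$ be a compatible basic data and let $\beta,\beta':G\to C(G;\mathbb T)$ be two pseudo-trivializations of $\gamma$, connected by $\beta'=\delta^0(a)\beta$ with $a\in C(G;\mathbb T)$. Let $M_a:L^2(G)\to L^2(G)$ be the unitary operator of multiplication by $a$. Then for every $\Phi\in\mathfrak C^\tau(\mathcal A,\gamma)$ one has $$\mathrm{Sch}^{\tau}_{\beta'}(\Phi)=M_a^*\,\mathrm{Sch}^\tau_\beta(\Phi)\,M_a .$$
   Context: $\mathsf m$ is a fixed Haar measure on $G$, $\mathsf e$ the unit. Basic data. $\mathcal{LUC}(G)$ is the $C^*$-algebra of bounded left uniformly continuous complex functions on $G$, on which left translations $[\mathsf L_y(c)](x)=c(y^{-1}x)$ act pointwise norm-continuously. A basic data is a pair $(\mathcal A,\gamma)$ where $\mathcal A$ is a $C^*$-subalgebra of $\mathcal{LUC}(G)$ invariant under all $\mathsf L_y$ and $\gamma:G\times G\times G\to\mathbb T$ is continuous with $\gamma(q;x,\mathsf e)=1=\gamma(q;\mathsf e,x)$ and $$\gamma(q;x,y)\,\gamma(q;xy,z)=\gamma(x^{-1}q;y,z)\,\gamma(q;x,yz)\quad\text{for all }q,x,y,z\in G.$$ One writes $[\gamma(x,y)](q)=\gamma(q;x,y)$. The data is compatible if $\gamma(x,y)\in\mathbb U(\mathcal A)$ for all $x,y$, where $\mathbb U(\mathcal A)$ is the unitary group of the multiplier algebra of $\mathcal A$ (multipliers being viewed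 as functions on $G$); then $(\mathcal A,\mathsf L,\gamma,G)$ is a twisted $C^*$-dynamical system (in particular $\gamma:G\times G\to\mathbb U(\mathcal A)$ is strictly continuous). Pseudo-trivializations. A pseudo-trivialization of $\gamma$ is a continuous map $\beta:G\times G\to\mathbb T$ (equivalently $\beta:G\to C(G;\mathbb T)$, $[\beta(x)](q)=\beta(q;x)$, with $C(G;\mathbb T)$ carrying uniform convergence on compact sets) with $\gamma(q;y,z)=\beta(q;y)\beta(y^{-1}q;z)\beta(q;yz)^{-1}$ for all $q,y,z$. For $a\in C(G;\mathbb T)$, $[\delta^0(a)](q;x)=a(x^{-1}q)a(q)^{-1}$. Twisted crossed product. For $\Phi\in L^1(G;\mathcal A)$ (Bochner integrable functions $G\to\mathcal A$) write $\Phi(q;x)=[\Phi(x)](q)$. $L^1(G;\mathcal A)$ is a Banach $^*$-algebra with $$(\Phi\diamond^{\tau}_{\gamma}\Psi)(q;x)=\int_G\Phi\big(\tau(y)^{-1}\tau(x)q;y\big)\Psi\big(\tau(y^{-1}x)^{-1}y^{-1}\tau(x)q;y^{-1}x\big)\gamma\big(\tau(x)q;y,y^{-1}x\big)\,d\mathsf m(y),$$ $$\Phi^{\diamond^{\tau}_{\gamma}}(q;x)=\overline{\gamma(\tau(x)q;x,x^{-1})}\;\overline{\Phi(\tau(x^{-1})^{-1}x^{-1}\tau(x)q;x^{-1})}.$$ Its enveloping $C^*$-algebra is denoted $\mathfrak C^\tau(\mathcal A,\gamma)$. The Schrödinger representation $\mathrm{Sch}^\tau_\beta:\mathfrak C^\tau(\mathcal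 A,\gamma)\to\mathbb B[L^2(G)]$ is the continuous extension of $$[\mathrm{Sch}^\tau_\beta(\Phi)u](q)=\int_G\beta(q;z)\,\Phi(\tau(z)^{-1}q;z)\,u(z^{-1}q)\,d\mathsf m(z),\quad \Phi\in L^1(G;\mathcal A),\ u\in L^2(G).$$ *)

theory Defs
  imports "HOL-Analysis.Analysis"
begin

section \<open>Unimodular second countable locally compact groups\<close>

text \<open>
  The class \<^class>\<open>group_add\<close> does not assume commutativity, so the library's topological groups
  are used as they are. In this additive notation the product \<open>xy\<close> is \<^term>\<open>x + y\<close> (the order
  matters), the inverse of \<open>x\<close> is \<^term>\<open>- x\<close> and the unit is \<^term>\<open>0\<close>.

  A Haar measure is a nonzero left invariant Borel measure that is finite on compact sets;
  regularity is automatic in the second countable case. One such measure is fixed as part of the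
  structure. The group is unimodular if this measure is right invariant as well.
\<close>

class lcsc_group = topological_group_add + t2_space + second_countable_topology +
  fixes haar :: "'a measure"
  assumes locally_compact_group: "\<exists>U K. open U \<and> compact K \<and> x \<in> U \<and> U \<subseteq> K"
    and sets_haar_sigma: "sets haar = sigma_sets UNIV {S. open S}"
    and haar_left_invariant: "distr haar haar (\<lambda>x. y + x) = haar"
    and haar_compact_finite: "compact K \<Longrightarrow> emeasure haar K < \<infinity>"
    and haar_nonzero: "emeasure haar UNIV \<noteq> 0"

class unimodular_group = lcsc_group +
  assumes haar_right_invariant: "distr haar haar (\<lambda>x. x + y) = haar"

lemma sets_haar [measurable_cong]: "sets haar = sets (borel :: 'g::lcsc_group measure)"
  by (simp add: sets_haar_sigma borel_def)

lemma space_haar [simp]: "space haar = (UNIV :: 'g::lcsc_group set)"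
  using sets_eq_imp_space_eq[OF sets_haar] by simp


section \<open>The Hilbert space of square integrable functions\<close>

definition square_integrable :: "('g::lcsc_group \<Rightarrow> complex) \<Rightarrow> bool" where
  "square_integrable u \<longleftrightarrow>
     u \<in> borel_measurable haar \<and> integrable haar (\<lambda>x. (cmod (u x))\<^sup>2)"

definition L2_rel :: "('g::lcsc_group \<Rightarrow> complex) \<Rightarrow> ('g \<Rightarrow> complex) \<Rightarrow> bool" where
  "L2_rel u v \<longleftrightarrow> square_integrable u \<and> square_integrable v \<and> (AE x in haar. u x = v x)"

lemma square_integrable_0: "square_integrable (\<lambda>x. 0)"
  by (simp add: square_integrable_def)

lemma square_integrable_scaleC:
  assumes "square_integrable u"
  shows "square_integrable (\<lambda>x. c * u x)"
  using assms by (auto simp: square_integrable_def norm_mult power_mult_distrib)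

lemma square_integrable_add:
  assumes u: "square_integrable u" and v: "square_integrable v"
  shows "square_integrable (\<lambda>x. u x + v x)"
proof -
  have [measurable]: "u \<in> borel_measurable haar" "v \<in> borel_measurable haar"
    using assms by (auto simp: square_integrable_def)
  have "integrable haar (\<lambda>x. 2 * (cmod (u x))\<^sup>2 + 2 * (cmod (v x))\<^sup>2)"
    using assms by (auto simp: square_integrable_def)
  moreover have "(cmod (u x + v x))\<^sup>2 \<le> 2 * (cmod (u x))\<^sup>2 + 2 * (cmod (v x))\<^sup>2" for x
  proof -
    have "(cmod (u x + v x))\<^sup>2 \<le> (cmod (u x) + cmod (v x))\<^sup>2"
      by (simp add: norm_triangle_ineq power_mono)
    also have "\<dots> \<le> 2 * (cmod (u x))\<^sup>2 + 2 * (cmod (v x))\<^sup>2"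
      using sum_squares_bound[of "cmod (u x)" "cmod (v x)"] by (simp add: power2_sum)
    finally show ?thesis .
  qed
  ultimately have "integrable haar (\<lambda>x. (cmod (u x + v x))\<^sup>2)"
    by (intro Bochner_Integration.integrable_bound[where g = "\<lambda>x. (cmod (u x + v x))\<^sup>2"
          and f = "\<lambda>x. 2 * (cmod (u x))\<^sup>2 + 2 * (cmod (v x))\<^sup>2"]) auto
  then show ?thesis by (simp add: square_integrable_def)
qed

lemma integrable_L2_product:
  assumes "square_integrable u" "square_integrable v"
  shows "integrable haar (\<lambda>x. u x * cnj (v x))"
proof -
  have [measurable]: "u \<in> borel_measurable haar" "v \<in> borel_measurable haar"
    using assms by (auto simp: square_integrable_def)
  have "integrable haar (\<lambda>x. (cmod (u x))\<^sup>2 + (cmod (v x))\<^sup>2)"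
    using assms by (auto simp: square_integrable_def)
  moreover have "cmod (u x * cnj (v x)) \<le> (cmod (u x))\<^sup>2 + (cmod (v x))\<^sup>2" for x
  proof -
    have "2 * (cmod (u x) * cmod (v x)) \<le> (cmod (u x))\<^sup>2 + (cmod (v x))\<^sup>2"
      using sum_squares_bound[of "cmod (u x)" "cmod (v x)"] by (simp add: mult.assoc)
    moreover have "0 \<le> cmod (u x) * cmod (v x)" by simp
    ultimately show ?thesis unfolding norm_mult complex_mod_cnj by linarith
  qed
  moreover have "(\<lambda>x. u x * cnj (v x)) \<in> borel_measurable haar"
    by (intro borel_measurable_times measurable_compose[of v haar borel cnj borel]
          borel_measurable_continuous_onI) (auto intro: continuous_intros)
  ultimately show ?thesis
    by (intro Bochner_Integration.integrable_bound[where g = "\<lambda>x. u x * cnj (v x)"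
          and f = "\<lambda>x. (cmod (u x))\<^sup>2 + (cmod (v x))\<^sup>2"]) auto
qed

lemma L2_rel_part_equivp: "part_equivp (L2_rel :: ('g::lcsc_group \<Rightarrow> complex) \<Rightarrow> _)"
proof (rule part_equivpI)
  show "\<exists>u::'g \<Rightarrow> complex. L2_rel u u"
    by (auto simp: L2_rel_def intro: square_integrable_0)
  show "symp (L2_rel :: ('g \<Rightarrow> complex) \<Rightarrow> _)"
    by (auto simp: symp_def L2_rel_def)
  show "transp (L2_rel :: ('g \<Rightarrow> complex) \<Rightarrow> _)"
    unfolding transp_def L2_rel_def
  proof (intro allI impI conjI)
    fix u v w :: "'g \<Rightarrow> complex"
    assume uv: "square_integrable u \<and> square_integrable v \<and> (AE x in haar. u x = v x)"
      and vw: "square_integrable v \<and> square_integrable w \<and> (AE x in haar. v x = w x)"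
    show "square_integrable u" "square_integrable w" using uv vw by auto
    from uv have 1: "AE x in haar. u x = v x" by simp
    from vw have 2: "AE x in haar. v x = w x" by simp
    from 1 2 show "AE x in haar. u x = w x" by eventually_elim simp
  qed
qed

quotient_type (overloaded) 'g L2 = "'g::lcsc_group \<Rightarrow> complex" / partial: L2_rel
  by (rule L2_rel_part_equivp)

lift_definition cinner_L2 :: "'g::lcsc_group L2 \<Rightarrow> 'g L2 \<Rightarrow> complex"
  is "\<lambda>u v. \<integral>x. u x * cnj (v x) \<partial>haar"
proof -
  fix u u' v v' :: "'g \<Rightarrow> complex"
  assume u: "L2_rel u u'" and v: "L2_rel v v'"
  then have [measurable]: "u \<in> borel_measurable haar" "u' \<in> borel_measurable haar"
      "v \<in> borel_measurable haar" "v' \<in> borel_measurable haar"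
    by (auto simp: L2_rel_def square_integrable_def)
  from u have 1: "AE x in haar. u x = u' x" by (simp add: L2_rel_def)
  from v have 2: "AE x in haar. v x = v' x" by (simp add: L2_rel_def)
  from 1 2 have "AE x in haar. u x * cnj (v x) = u' x * cnj (v' x)"
    by eventually_elim simp
  then show "(\<integral>x. u x * cnj (v x) \<partial>haar) = (\<integral>x. u' x * cnj (v' x) \<partial>haar)"
    using u v
    by (intro integral_cong_AE)
      (auto simp: L2_rel_def dest: integrable_L2_product intro: borel_measurable_integrable)
qed

text \<open>
  The library has no class of complex inner product spaces. The norm of \<open>L2\<close>, and with it the
  operator norm, is the one of the real inner product \<^term>\<open>Re (cinner_L2 u v)\<close>.
\<close>

instantiation L2 :: (lcsc_group) real_inner
begin

lift_definition zero_L2 :: "'a L2" is "\<lambda>x. 0"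
  by (simp add: L2_rel_def square_integrable_0)

lift_definition plus_L2 :: "'a L2 \<Rightarrow> 'a L2 \<Rightarrow> 'a L2" is "\<lambda>u v x. u x + v x"
proof -
  fix u u' v v' :: "'a \<Rightarrow> complex"
  assume u: "L2_rel u u'" and v: "L2_rel v v'"
  from u have 1: "AE x in haar. u x = u' x" by (simp add: L2_rel_def)
  from v have 2: "AE x in haar. v x = v' x" by (simp add: L2_rel_def)
  from 1 2 have "AE x in haar. u x + v x = u' x + v' x"
    by eventually_elim simp
  then show "L2_rel (\<lambda>x. u x + v x) (\<lambda>x. u' x + v' x)"
    using u v by (auto simp: L2_rel_def intro: square_integrable_add)
qed

lift_definition scaleR_L2 :: "real \<Rightarrow> 'a L2 \<Rightarrow> 'a L2" is "\<lambda>r u x. complex_of_real r * u x"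
  by (auto simp: L2_rel_def intro: square_integrable_scaleC)

definition uminus_L2 :: "'a L2 \<Rightarrow> 'a L2" where "uminus_L2 u = (-1) *\<^sub>R u"

definition minus_L2 :: "'a L2 \<Rightarrow> 'a L2 \<Rightarrow> 'a L2" where "minus_L2 u v = u + (- v)"

definition inner_L2 :: "'a L2 \<Rightarrow> 'a L2 \<Rightarrow> real" where "inner_L2 u v = Re (cinner_L2 u v)"

definition norm_L2 :: "'a L2 \<Rightarrow> real" where "norm_L2 u = sqrt (inner u u)"

definition sgn_L2 :: "'a L2 \<Rightarrow> 'a L2" where "sgn_L2 u = inverse (norm u) *\<^sub>R u"

definition dist_L2 :: "'a L2 \<Rightarrow> 'a L2 \<Rightarrow> real" where "dist_L2 u v = norm (u - v)"

definition uniformity_L2 :: "('a L2 \<times> 'a L2) filter" where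
  "uniformity_L2 = (INF e\<in>{0<..}. principal {(x, y). dist x y < e})"

definition open_L2 :: "'a L2 set \<Rightarrow> bool" where
  "open_L2 U \<longleftrightarrow> (\<forall>x\<in>U. eventually (\<lambda>(x', y). x' = x \<longrightarrow> y \<in> U) uniformity)"

instance
proof
  fix u v w :: "'a L2" and r s :: real
  show "u + v + w = u + (v + w)"
    by transfer (auto simp: L2_rel_def add.assoc intro!: square_integrable_add)
  show "u + v = v + u"
    by transfer (auto simp: L2_rel_def add.commute intro!: square_integrable_add)
  show "0 + u = u"
    by transfer (auto simp: L2_rel_def)
  show "- u + u = 0"
    unfolding uminus_L2_def
    by transfer (auto simp: L2_rel_def square_integrable_0)
  show "u - v = u + - v" by (simp add: minus_L2_def)
  show "r *\<^sub>R (u + v) = r *\<^sub>R u + r *\<^sub>R v"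
    by transfer (auto simp: L2_rel_def distrib_left
        intro!: square_integrable_add square_integrable_scaleC)
  show "(r + s) *\<^sub>R u = r *\<^sub>R u + s *\<^sub>R u"
    by transfer (auto simp: L2_rel_def distrib_right
        intro!: square_integrable_add square_integrable_scaleC)
  show "r *\<^sub>R s *\<^sub>R u = (r * s) *\<^sub>R u"
    by transfer (auto simp: L2_rel_def mult.assoc
        intro!: square_integrable_scaleC)
  show "1 *\<^sub>R u = u"
    by transfer (auto simp: L2_rel_def)
  show "sgn u = inverse (norm u) *\<^sub>R u" by (simp add: sgn_L2_def)
  show "dist u v = norm (u - v)" by (simp add: dist_L2_def)
  show "(uniformity :: ('a L2 \<times> 'a L2) filter) = (INF e\<in>{0<..}. principal {(x, y). dist x y < e})"
    by (simp add: uniformity_L2_def)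
  show "open U \<longleftrightarrow> (\<forall>x\<in>U. eventually (\<lambda>(x', y). x' = x \<longrightarrow> y \<in> U) uniformity)"
    for U :: "'a L2 set" by (simp add: open_L2_def)
  have "cinner_L2 u v = cnj (cinner_L2 v u)"
    by transfer (simp add: Bochner_Integration.integral_cnj[symmetric] mult.commute
        del: Bochner_Integration.integral_cnj)
  then show "inner u v = inner v u" by (simp add: inner_L2_def)
  have "cinner_L2 (u + v) w = cinner_L2 u w + cinner_L2 v w"
    by transfer
      (simp add: L2_rel_def distrib_right integrable_L2_product)
  then show "inner (u + v) w = inner u w + inner v w" by (simp add: inner_L2_def)
  have "cinner_L2 (r *\<^sub>R u) v = of_real r * cinner_L2 u v"
    by transfer (simp add: mult.assoc)
  then show "inner (r *\<^sub>R u) v = r * inner u v" by (simp add: inner_L2_def)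
  have *: "cinner_L2 u u = of_real (Re (cinner_L2 u u)) \<and> 0 \<le> Re (cinner_L2 u u) \<and>
      (Re (cinner_L2 u u) = 0 \<longleftrightarrow> u = 0)"
  proof (transfer, goal_cases)
    case (1 u)
    then have int: "integrable haar (\<lambda>x. (cmod (u x))\<^sup>2)"
      and sq: "square_integrable u"
      by (auto simp: L2_rel_def square_integrable_def)
    have eq: "(\<integral>x. u x * cnj (u x) \<partial>haar) = of_real (\<integral>x. (cmod (u x))\<^sup>2 \<partial>haar)"
      by (simp add: complex_norm_square[symmetric] del: of_real_power)
    have "(\<integral>x. (cmod (u x))\<^sup>2 \<partial>haar) = 0 \<longleftrightarrow> (AE x in haar. (cmod (u x))\<^sup>2 = 0)"
      by (rule integral_nonneg_eq_0_iff_AE[OF int]) simp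
    then show ?case
      unfolding eq using sq by (simp add: L2_rel_def square_integrable_0)
  qed
  show "0 \<le> inner u u" "inner u u = 0 \<longleftrightarrow> u = 0"
    using * by (auto simp: inner_L2_def)
  show "norm u = sqrt (inner u u)" by (simp add: norm_L2_def)
qed

end

text \<open>The adjoint with respect to the complex inner product.\<close>

definition adj_L2 :: "('g::lcsc_group L2 \<Rightarrow>\<^sub>L 'g L2) \<Rightarrow> ('g L2 \<Rightarrow>\<^sub>L 'g L2)" where
  "adj_L2 S = (THE T. \<forall>u v. cinner_L2 (blinfun_apply T u) v = cinner_L2 u (blinfun_apply S v))"

definition mult_op :: "('g::lcsc_group \<Rightarrow> complex) \<Rightarrow> ('g L2 \<Rightarrow>\<^sub>L 'g L2)" where
  "mult_op a = Blinfun (\<lambda>u. abs_L2 (\<lambda>q. a q * rep_L2 u q))"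


section \<open>Basic data\<close>

setup_lifting type_definition_bcontfun

lift_definition bc_mult :: "('g::topological_space \<Rightarrow>\<^sub>C complex) \<Rightarrow> ('g \<Rightarrow>\<^sub>C complex) \<Rightarrow> ('g \<Rightarrow>\<^sub>C complex)"
  is "\<lambda>f g x. f x * g x"
proof -
  fix f g :: "'g \<Rightarrow> complex"
  assume "f \<in> bcontfun" "g \<in> bcontfun"
  then obtain B C where cont: "continuous_on UNIV f" "continuous_on UNIV g"
    and B: "\<And>x. cmod (f x) \<le> B" and C: "\<And>x. cmod (g x) \<le> C"
    by (auto simp: bcontfun_def bounded_iff)
  have "cmod (f x * g x) \<le> B * C" for x
    unfolding norm_mult using B[of x] C[of x] by (intro mult_mono') auto
  then show "(\<lambda>x. f x * g x) \<in> bcontfun"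
    using cont by (auto simp: bcontfun_def bounded_iff intro!: continuous_on_mult)
qed

lift_definition bc_cnj :: "('g::topological_space \<Rightarrow>\<^sub>C complex) \<Rightarrow> ('g \<Rightarrow>\<^sub>C complex)"
  is "\<lambda>f x. cnj (f x)"
  by (auto simp: bcontfun_def bounded_iff intro!: continuous_intros)

definition bc_scaleC :: "complex \<Rightarrow> ('g::topological_space \<Rightarrow>\<^sub>C complex) \<Rightarrow> ('g \<Rightarrow>\<^sub>C complex)" where
  "bc_scaleC k f = bc_mult (const_bcontfun k) f"

lift_definition left_translate :: "'g::topological_group_add \<Rightarrow> ('g \<Rightarrow>\<^sub>C complex) \<Rightarrow> ('g \<Rightarrow>\<^sub>C complex)"
  is "\<lambda>y c x. c (- y + x)"
proof -
  fix y :: 'g and c :: "'g \<Rightarrow> complex"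
  assume "c \<in> bcontfun"
  then have c: "continuous_on UNIV c" "bounded (range c)" by (auto simp: bcontfun_def)
  have "continuous_on UNIV (\<lambda>x. c (- y + x))"
    by (rule continuous_on_compose2[OF c(1)]) (auto intro!: continuous_intros)
  moreover have "bounded (range (\<lambda>x. c (- y + x)))"
    by (rule bounded_subset[OF c(2)]) auto
  ultimately show "(\<lambda>x. c (- y + x)) \<in> bcontfun" by (simp add: bcontfun_def)
qed

text \<open>
  Conventions for left and right uniform continuity vary: this is the one for which
  \<open>y \<mapsto> left_translate y c\<close> is norm continuous.
\<close>

definition LUC :: "('g::topological_group_add \<Rightarrow>\<^sub>C complex) set" where
  "LUC = {c. \<forall>e>0. \<forall>\<^sub>F y in nhds 0. \<forall>x. cmod (apply_bcontfun c (- y + x) - apply_bcontfun c x) < e}"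

definition cstar_subalgebra :: "('g::topological_space \<Rightarrow>\<^sub>C complex) set \<Rightarrow> bool" where
  "cstar_subalgebra A \<longleftrightarrow>
     0 \<in> A \<and> (\<forall>f\<in>A. \<forall>g\<in>A. f + g \<in> A) \<and> (\<forall>k. \<forall>f\<in>A. bc_scaleC k f \<in> A) \<and>
     (\<forall>f\<in>A. \<forall>g\<in>A. bc_mult f g \<in> A) \<and> (\<forall>f\<in>A. bc_cnj f \<in> A) \<and> closed A"

definition basic_data ::
  "('g::topological_group_add \<Rightarrow>\<^sub>C complex) set \<Rightarrow> ('g \<Rightarrow> 'g \<Rightarrow> 'g \<Rightarrow> complex) \<Rightarrow> bool" where
  "basic_data A \<gamma> \<longleftrightarrow>
     cstar_subalgebra A \<and> A \<subseteq> LUC \<and> (\<forall>y. \<forall>c\<in>A. left_translate y c \<in> A) \<and>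
     continuous_on UNIV (\<lambda>(q, x, y). \<gamma> q x y) \<and> (\<forall>q x y. cmod (\<gamma> q x y) = 1) \<and>
     (\<forall>q x. \<gamma> q x 0 = 1 \<and> \<gamma> q 0 x = 1) \<and>
     (\<forall>q x y z. \<gamma> q x y * \<gamma> q (x + y) z = \<gamma> (- x + q) y z * \<gamma> q x (y + z))"

text \<open>
  A left invariant subalgebra \<open>A \<noteq> {0}\<close> has no common zero, so a multiplier of \<open>A\<close> is
  multiplication by a unique function on the group, which is bounded and continuous.
\<close>

definition multiplier_algebra ::
  "('g::topological_space \<Rightarrow>\<^sub>C complex) set \<Rightarrow> ('g \<Rightarrow>\<^sub>C complex) set" where
  "multiplier_algebra A = {m. \<forall>c\<in>A. bc_mult m c \<in> A}"

definition unitary_multipliers ::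
  "('g::topological_space \<Rightarrow>\<^sub>C complex) set \<Rightarrow> ('g \<Rightarrow>\<^sub>C complex) set" where
  "unitary_multipliers A =
     {m \<in> multiplier_algebra A. bc_cnj m \<in> multiplier_algebra A \<and> bc_mult m (bc_cnj m) = const_bcontfun 1}"

definition compatible ::
  "('g::topological_group_add \<Rightarrow>\<^sub>C complex) set \<Rightarrow> ('g \<Rightarrow> 'g \<Rightarrow> 'g \<Rightarrow> complex) \<Rightarrow> bool" where
  "compatible A \<gamma> \<longleftrightarrow>
     (\<forall>x y. \<exists>m\<in>unitary_multipliers A. \<forall>q. apply_bcontfun m q = \<gamma> q x y)"

text \<open>
  On a locally compact group, continuous maps \<open>G \<rightarrow> C(G;T)\<close> (compact convergence) are
  the same as jointly continuous maps \<open>G \<times> G \<rightarrow> T\<close>; \<open>\<beta> q x\<close> stands for \<open>[\<beta>(x)](q)\<close>.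
\<close>

definition pseudo_trivialization ::
  "('g::topological_group_add \<Rightarrow> 'g \<Rightarrow> 'g \<Rightarrow> complex) \<Rightarrow> ('g \<Rightarrow> 'g \<Rightarrow> complex) \<Rightarrow> bool" where
  "pseudo_trivialization \<gamma> \<beta> \<longleftrightarrow>
     continuous_on UNIV (\<lambda>(q, x). \<beta> q x) \<and> (\<forall>q x. cmod (\<beta> q x) = 1) \<and>
     (\<forall>q y z. \<gamma> q y z = \<beta> q y * \<beta> (- y + q) z * inverse (\<beta> q (y + z)))"

definition coboundary0 :: "('g::group_add \<Rightarrow> complex) \<Rightarrow> 'g \<Rightarrow> 'g \<Rightarrow> complex" where
  "coboundary0 a q x = a (- x + q) * inverse (a q)"


section \<open>The twisted crossed product\<close>

text \<open>
  The library's Bochner integral requires a second countable target, which \<open>A\<close> need not be.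
  The space \<open>L1(G;A)\<close> is therefore given by its representatives: the pointwise limits of
  \<open>A\<close>-valued simple functions whose norm is integrable. Every class modulo null sets has such a
  representative. A function \<open>\<Phi>(q;x) = [\<Phi>(x)](q)\<close> is written \<open>\<Phi> x q\<close> here.
\<close>

definition bochner_L1 ::
  "('g::lcsc_group \<Rightarrow>\<^sub>C complex) set \<Rightarrow> ('g \<Rightarrow> ('g \<Rightarrow>\<^sub>C complex)) set" where
  "bochner_L1 A = {\<Phi>.
     (\<exists>s. (\<forall>n. simple_function haar (s n) \<and> range (s n) \<subseteq> A) \<and> (\<forall>x. (\<lambda>n. s n x) \<longlonglongrightarrow> \<Phi> x)) \<and>
     integrable haar (\<lambda>x. norm (\<Phi> x))}"

definition L1_norm :: "('g::lcsc_group \<Rightarrow> ('g \<Rightarrow>\<^sub>C complex)) \<Rightarrow> real" where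
  "L1_norm \<Phi> = (\<integral>x. norm (\<Phi> x) \<partial>haar)"

text \<open>
  Product and involution of classes modulo null sets: \<open>\<Xi>\<close> represents the product of
  \<open>\<Phi>\<close> and \<open>\<Psi>\<close>, respectively the adjoint of \<open>\<Phi>\<close>.
\<close>

definition twisted_product ::
  "('g::lcsc_group \<Rightarrow> 'g) \<Rightarrow> ('g \<Rightarrow> 'g \<Rightarrow> 'g \<Rightarrow> complex) \<Rightarrow>
   ('g \<Rightarrow> ('g \<Rightarrow>\<^sub>C complex)) \<Rightarrow> ('g \<Rightarrow> ('g \<Rightarrow>\<^sub>C complex)) \<Rightarrow> ('g \<Rightarrow> ('g \<Rightarrow>\<^sub>C complex)) \<Rightarrow> bool" where
  "twisted_product \<tau> \<gamma> \<Phi> \<Psi> \<Xi> \<longleftrightarrow>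
     (AE x in haar. \<forall>q. apply_bcontfun (\<Xi> x) q =
        (\<integral>y. apply_bcontfun (\<Phi> y) (- \<tau> y + \<tau> x + q) *
             apply_bcontfun (\<Psi> (- y + x)) (- \<tau> (- y + x) + - y + \<tau> x + q) *
             \<gamma> (\<tau> x + q) y (- y + x) \<partial>haar))"

definition twisted_adjoint ::
  "('g::lcsc_group \<Rightarrow> 'g) \<Rightarrow> ('g \<Rightarrow> 'g \<Rightarrow> 'g \<Rightarrow> complex) \<Rightarrow>
   ('g \<Rightarrow> ('g \<Rightarrow>\<^sub>C complex)) \<Rightarrow> ('g \<Rightarrow> ('g \<Rightarrow>\<^sub>C complex)) \<Rightarrow> bool" where
  "twisted_adjoint \<tau> \<gamma> \<Phi> \<Xi> \<longleftrightarrow>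
     (AE x in haar. \<forall>q. apply_bcontfun (\<Xi> x) q =
        cnj (\<gamma> (\<tau> x + q) x (- x)) *
        cnj (apply_bcontfun (\<Phi> (- x)) (- \<tau> (- x) + - x + \<tau> x + q)))"

text \<open>
  The enveloping \<open>C\<^sup>*\<close>-algebra is the completion of the Banach \<open>*\<close>-algebra with respect to its
  greatest \<open>C\<^sup>*\<close>-seminorm. The \<open>C\<^sup>*\<close>-seminorms are exactly the functions \<open>\<Phi> \<mapsto> \<parallel>\<pi>(\<Phi>)\<parallel>\<close> for
  \<open>*\<close>-morphisms \<open>\<pi>\<close> into \<open>C\<^sup>*\<close>-algebras. Being dominated by \<^const>\<open>L1_norm\<close>, they depend only on
  the class of \<open>\<Phi>\<close> modulo null sets.
\<close>

definition cstar_seminorm ::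
  "('g::lcsc_group \<Rightarrow> 'g) \<Rightarrow> ('g \<Rightarrow>\<^sub>C complex) set \<Rightarrow> ('g \<Rightarrow> 'g \<Rightarrow> 'g \<Rightarrow> complex) \<Rightarrow>
   (('g \<Rightarrow> ('g \<Rightarrow>\<^sub>C complex)) \<Rightarrow> real) \<Rightarrow> bool" where
  "cstar_seminorm \<tau> A \<gamma> p \<longleftrightarrow>
     (\<forall>\<Phi>\<in>bochner_L1 A. 0 \<le> p \<Phi> \<and> p \<Phi> \<le> L1_norm \<Phi>) \<and>
     (\<forall>\<Phi>\<in>bochner_L1 A. \<forall>\<Psi>\<in>bochner_L1 A. p (\<lambda>x. \<Phi> x + \<Psi> x) \<le> p \<Phi> + p \<Psi>) \<and>
     (\<forall>k. \<forall>\<Phi>\<in>bochner_L1 A. p (\<lambda>x. bc_scaleC k (\<Phi> x)) = cmod k * p \<Phi>) \<and>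
     (\<forall>\<Phi>\<in>bochner_L1 A. \<forall>\<Psi>\<in>bochner_L1 A. \<forall>\<Xi>\<in>bochner_L1 A.
        twisted_product \<tau> \<gamma> \<Phi> \<Psi> \<Xi> \<longrightarrow> p \<Xi> \<le> p \<Phi> * p \<Psi>) \<and>
     (\<forall>\<Phi>\<in>bochner_L1 A. \<forall>\<Psi>\<in>bochner_L1 A.
        twisted_adjoint \<tau> \<gamma> \<Phi> \<Psi> \<longrightarrow> p \<Psi> = p \<Phi>) \<and>
     (\<forall>\<Phi>\<in>bochner_L1 A. \<forall>\<Psi>\<in>bochner_L1 A. \<forall>\<Xi>\<in>bochner_L1 A.
        twisted_adjoint \<tau> \<gamma> \<Phi> \<Psi> \<longrightarrow> twisted_product \<tau> \<gamma> \<Psi> \<Phi> \<Xi> \<longrightarrow> p \<Xi> = (p \<Phi>)\<^sup>2)"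

definition enveloping_norm ::
  "('g::lcsc_group \<Rightarrow> 'g) \<Rightarrow> ('g \<Rightarrow>\<^sub>C complex) set \<Rightarrow> ('g \<Rightarrow> 'g \<Rightarrow> 'g \<Rightarrow> complex) \<Rightarrow>
   ('g \<Rightarrow> ('g \<Rightarrow>\<^sub>C complex)) \<Rightarrow> real" where
  "enveloping_norm \<tau> A \<gamma> \<Phi> = Sup {p \<Phi> | p. cstar_seminorm \<tau> A \<gamma> p}"

text \<open>The completion, as Cauchy sequences modulo null sequences.\<close>

definition enveloping_Cauchy ::
  "('g::lcsc_group \<Rightarrow> 'g) \<Rightarrow> ('g \<Rightarrow>\<^sub>C complex) set \<Rightarrow> ('g \<Rightarrow> 'g \<Rightarrow> 'g \<Rightarrow> complex) \<Rightarrow>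
   (nat \<Rightarrow> 'g \<Rightarrow> ('g \<Rightarrow>\<^sub>C complex)) set" where
  "enveloping_Cauchy \<tau> A \<gamma> = {s. (\<forall>n. s n \<in> bochner_L1 A) \<and>
     (\<forall>e>0. \<exists>N. \<forall>m\<ge>N. \<forall>n\<ge>N. enveloping_norm \<tau> A \<gamma> (\<lambda>x. s m x - s n x) < e)}"

definition crossed_product ::
  "('g::lcsc_group \<Rightarrow> 'g) \<Rightarrow> ('g \<Rightarrow>\<^sub>C complex) set \<Rightarrow> ('g \<Rightarrow> 'g \<Rightarrow> 'g \<Rightarrow> complex) \<Rightarrow>
   (nat \<Rightarrow> 'g \<Rightarrow> ('g \<Rightarrow>\<^sub>C complex)) set set" where
  "crossed_product \<tau> A \<gamma> =
     enveloping_Cauchy \<tau> A \<gamma> //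
       {(s, t). s \<in> enveloping_Cauchy \<tau> A \<gamma> \<and> t \<in> enveloping_Cauchy \<tau> A \<gamma> \<and>
                (\<lambda>n. enveloping_norm \<tau> A \<gamma> (\<lambda>x. s n x - t n x)) \<longlonglongrightarrow> 0}"


section \<open>The Schroedinger representation\<close>

definition Sch_L1 ::
  "('g::lcsc_group \<Rightarrow> 'g) \<Rightarrow> ('g \<Rightarrow> 'g \<Rightarrow> complex) \<Rightarrow> ('g \<Rightarrow> ('g \<Rightarrow>\<^sub>C complex)) \<Rightarrow>
   ('g L2 \<Rightarrow>\<^sub>L 'g L2)" where
  "Sch_L1 \<tau> \<beta> \<Phi> = Blinfun (\<lambda>u. abs_L2 (\<lambda>q.
     \<integral>z. \<beta> q z * apply_bcontfun (\<Phi> z) (- \<tau> z + q) * rep_L2 u (- z + q) \<partial>haar))"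

text \<open>
  The continuous extension to the completion: its value at the class \<open>F\<close> of Cauchy sequences is the
  common operator norm limit along the sequences in \<open>F\<close>. The limit exists for
  \<open>F \<in> crossed_product \<tau> A \<gamma>\<close> and a pseudo-trivialization \<open>\<beta>\<close> of \<open>\<gamma>\<close>, because
  \<open>\<Phi> \<mapsto> \<parallel>Sch_L1 \<tau> \<beta> \<Phi>\<parallel>\<close> is then one of the seminorms below \<^const>\<open>enveloping_norm\<close>; the
  value 0 only makes the function total.
\<close>

definition Sch ::
  "('g::lcsc_group \<Rightarrow> 'g) \<Rightarrow> ('g \<Rightarrow> 'g \<Rightarrow> complex) \<Rightarrow> (nat \<Rightarrow> 'g \<Rightarrow> ('g \<Rightarrow>\<^sub>C complex)) set \<Rightarrow>
   ('g L2 \<Rightarrow>\<^sub>L 'g L2)" where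
  "Sch \<tau> \<beta> F =
     (if \<exists>!T. \<forall>s\<in>F. (\<lambda>n. Sch_L1 \<tau> \<beta> (s n)) \<longlonglongrightarrow> T
      then THE T. \<forall>s\<in>F. (\<lambda>n. Sch_L1 \<tau> \<beta> (s n)) \<longlonglongrightarrow> T
      else 0)"

end

theory Submission
  imports Defs
begin

text \<open>
  On representatives \<open>\<Phi> \<in> L1(G;A)\<close> the identity is the pointwise computation
  \<open>\<beta>'(q;z) = a(z\<^sup>-\<^sup>1q) a(q)\<^sup>-\<^sup>1 \<beta>(q;z)\<close>, once \<open>Sch\<close> is known to be a bounded operator on \<open>L\<^sup>2\<close>: its
  kernel is dominated by \<open>\<parallel>\<Phi>(z)\<parallel>\<close>, and Cauchy-Schwarz with Tonelli and left invariance bound it by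
  \<open>\<parallel>\<Phi>\<parallel>\<^sub>1\<close>. Conjugation by the unitary \<open>M\<^sub>a\<close> is a homeomorphism of the operators, so it carries the
  limits defining one extension to those defining the other; convergence itself is never needed, as
  both sides take the junk value 0 together.
\<close>

section \<open>Haar measure: sigma-finiteness, measurability on pairs, translations\<close>

text \<open>The members of a countable basis that lie in compact sets suffice: every point has an
  open neighbourhood inside a compact set, and a basis set around the point fits into it.\<close>

lemma lcsc_countable_compact_cover:
  "\<exists>\<C>::'g::lcsc_group set set. countable \<C> \<and> (\<forall>C\<in>\<C>. open C \<and> (\<exists>K. compact K \<and> C \<subseteq> K)) \<and> \<Union>\<C> = UNIV"
proof -
  obtain B :: "'g set set" where B: "countable B" "topological_basis B"
    using ex_countable_basis by blast
  let ?C = "{b\<in>B. \<exists>K. compact K \<and> b \<subseteq> K}"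
  have "x \<in> \<Union>?C" for x :: 'g
  proof -
    obtain U K where UK: "open U" "compact K" "x \<in> U" "U \<subseteq> K"
      using locally_compact_group[of x] by blast
    then obtain b where "b \<in> B" "x \<in> b" "b \<subseteq> U"
      using topological_basisE[OF B(2)] by metis
    then show ?thesis using UK by blast
  qed
  moreover have "countable ?C" using B(1) by simp
  moreover have "\<forall>C\<in>?C. open C \<and> (\<exists>K. compact K \<and> C \<subseteq> K)"
    using topological_basis_open[OF B(2)] by blast
  ultimately show ?thesis by (intro exI[of _ ?C]) blast
qed

text \<open>Makes Tonelli's theorem and the measurability of parameter integrals available. The
  covering sets have finite measure because each lies in a compact set.\<close>

lemma sigma_finite_haar: "sigma_finite_measure (haar :: 'g::lcsc_group measure)"
proof
  obtain \<C> :: "'g set set" where C: "countable \<C>" "\<And>C. C \<in> \<C> \<Longrightarrow> open C"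
      "\<And>C. C \<in> \<C> \<Longrightarrow> \<exists>K. compact K \<and> C \<subseteq> K" "\<Union>\<C> = UNIV"
    using lcsc_countable_compact_cover by metis
  have "emeasure haar C \<noteq> \<infinity>" if "C \<in> \<C>" for C :: "'g set"
  proof -
    obtain K where K: "compact K" "C \<subseteq> K" using C(3)[OF \<open>C \<in> \<C>\<close>] by blast
    have "emeasure haar C \<le> emeasure haar K"
      using K by (intro emeasure_mono) (auto simp: sets_haar compact_imp_closed)
    then show ?thesis using haar_compact_finite[OF K(1)] by auto
  qed
  moreover have "\<C> \<subseteq> sets haar" using C(2) by (auto simp: sets_haar)
  ultimately show "\<exists>A. countable A \<and> A \<subseteq> sets (haar :: 'g measure) \<and> \<Union>A = space haar \<and>
      (\<forall>a\<in>A. emeasure haar a \<noteq> \<infinity>)"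
    using C by (intro exI[of _ \<C>]) auto
qed

interpretation haar: sigma_finite_measure "haar :: 'g::lcsc_group measure"
  by (rule sigma_finite_haar)

interpretation haar_pair: pair_sigma_finite "haar :: 'g::lcsc_group measure" "haar :: 'g measure"
  ..

text \<open>By second countability the product of the Borel sigma-algebras is the Borel
  sigma-algebra of the product space.\<close>

lemma haar_pair_measurable_continuous:
  fixes f :: "'g::lcsc_group \<times> 'g \<Rightarrow> 'b::topological_space"
  assumes "continuous_on UNIV f"
  shows "f \<in> borel_measurable (haar \<Otimes>\<^sub>M haar)"
proof -
  have "sets (haar \<Otimes>\<^sub>M haar :: ('g \<times> 'g) measure) = sets borel"
    unfolding borel_prod[symmetric] by (intro sets_pair_measure_cong sets_haar)
  then show ?thesis
    using borel_measurable_continuous_onI[OF assms] by (simp cong: measurable_cong_sets)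
qed

text \<open>Since \<open>haar\<close> carries exactly the Borel sets, composing \<open>u\<close>
  with a continuous map of the pair preserves measurability.\<close>

lemma measurable_left_shift_pair:
  assumes "u \<in> borel_measurable (haar :: 'g::lcsc_group measure)"
  shows "(\<lambda>(q, z). u (- z + q)) \<in> borel_measurable (haar \<Otimes>\<^sub>M haar)"
proof -
  have "(\<lambda>p::'g \<times> 'g. - snd p + fst p) \<in> borel_measurable (haar \<Otimes>\<^sub>M haar)"
    by (intro haar_pair_measurable_continuous continuous_intros)
  then have "(\<lambda>p::'g \<times> 'g. - snd p + fst p) \<in> (haar \<Otimes>\<^sub>M haar) \<rightarrow>\<^sub>M haar"
    by (simp cong: measurable_cong_sets add: sets_haar)
  from measurable_compose[OF this assms] show ?thesis by (simp add: split_beta')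
qed

lemma measurable_left_shift: "(\<lambda>x. y + x) \<in> (haar :: 'g::lcsc_group measure) \<rightarrow>\<^sub>M haar"
proof -
  have "(\<lambda>x::'g. y + x) \<in> borel \<rightarrow>\<^sub>M borel"
    by (intro borel_measurable_continuous_onI continuous_intros)
  then show ?thesis by (simp cong: measurable_cong_sets add: sets_haar)
qed

lemma nn_integral_haar_shift:
  assumes "f \<in> borel_measurable (haar :: 'g::lcsc_group measure)"
  shows "(\<integral>\<^sup>+x. f (y + x) \<partial>haar) = (\<integral>\<^sup>+x. f x \<partial>haar)"
  using nn_integral_distr[OF measurable_left_shift, of f y] assms
  by (simp add: haar_left_invariant)

lemma AE_haar_shift:
  assumes "AE x in haar. P (x::'g::lcsc_group)"
  shows "AE x in haar. P (y + x)"
  using assms by (intro AE_distrD[OF measurable_left_shift]) (simp only: haar_left_invariant)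

section \<open>Integral operators dominated by convolution with an integrable function\<close>

text \<open>Abstracts the Schroedinger integrand, with \<open>\<beta>\<close> and
  \<open>\<Phi>\<close> merged into \<open>k\<close>. As the majorant does not depend on
  \<open>q\<close>, the operator is controlled by convolution with \<open>\<phi>\<close>.\<close>

locale dominated_kernel =
  fixes k :: "'g::lcsc_group \<Rightarrow> 'g \<Rightarrow> complex" and \<phi> :: "'g \<Rightarrow> real"
  assumes kernel_measurable [measurable]: "(\<lambda>(q, z). k q z) \<in> borel_measurable (haar \<Otimes>\<^sub>M haar)"
    and kernel_bound: "cmod (k q z) \<le> \<phi> z"
    and majorant_integrable: "integrable haar \<phi>"
begin

text \<open>The integral is 0 by convention at points \<open>q\<close> where the integrand is not
  integrable; for square integrable \<open>u\<close> these form a null set, by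
  \<open>kernel_integrand_integrable\<close>.\<close>

definition kernel_op :: "('g \<Rightarrow> complex) \<Rightarrow> 'g \<Rightarrow> complex" where
  "kernel_op u q = (\<integral>z. k q z * u (- z + q) \<partial>haar)"

lemma majorant_measurable [measurable]: "\<phi> \<in> borel_measurable haar"
  using majorant_integrable by blast

lemma majorant_nonneg: "0 \<le> \<phi> z"
  using order_trans[OF norm_ge_zero kernel_bound] .

lemma kernel_op_measurable:
  assumes "u \<in> borel_measurable haar"
  shows "kernel_op u \<in> borel_measurable haar"
proof -
  have "(\<lambda>(q, z). k q z * u (- z + q)) \<in> borel_measurable (haar \<Otimes>\<^sub>M haar)"
    using borel_measurable_times[OF kernel_measurable measurable_left_shift_pair[OF assms]]
    by (simp add: split_beta')
  then show ?thesis
    unfolding kernel_op_def by (rule haar.borel_measurable_lebesgue_integral)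
qed

text \<open>For each fixed \<open>z\<close> the translated exceptional set is null. Exchanging the
  two almost-everywhere quantifiers shows that for almost every \<open>q\<close> the integrands
  agree for almost every \<open>z\<close>.\<close>

lemma kernel_op_cong_AE:
  assumes [measurable]: "u \<in> borel_measurable haar" "v \<in> borel_measurable haar"
    and uv: "AE x in haar. u x = v x"
  shows "AE q in haar. kernel_op u q = kernel_op v q"
proof -
  note [measurable] = measurable_left_shift_pair[OF assms(1)] measurable_left_shift_pair[OF assms(2)]
  have "AE z in haar. AE q in haar. u (- z + q) = v (- z + q)"
    by (intro AE_I2 AE_haar_shift[OF uv])
  then have "AE q in haar. AE z in haar. u (- z + q) = v (- z + q)"
    by (subst haar_pair.AE_commute) measurable
  then show ?thesis
  proof eventually_elim
    case (elim q)
    have "(\<lambda>z. k q z * u (- z + q)) \<in> borel_measurable haar"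
      by measurable
    moreover have "(\<lambda>z. k q z * v (- z + q)) \<in> borel_measurable haar"
      by measurable
    ultimately show ?case
      unfolding kernel_op_def using elim by (intro integral_cong_AE) auto
  qed
qed

text \<open>Young's inequality for an L1 function convolved with an L2 function, in extended
  nonnegative reals so that finiteness can be read off afterwards.\<close>

lemma nn_integral_majorant_sq:
  assumes [measurable]: "u \<in> borel_measurable haar"
  shows "(\<integral>\<^sup>+q. (\<integral>\<^sup>+z. ennreal (\<phi> z * cmod (u (- z + q))) \<partial>haar)\<^sup>2 \<partial>haar)
    \<le> ennreal ((\<integral>z. \<phi> z \<partial>haar)\<^sup>2) * (\<integral>\<^sup>+x. ennreal ((cmod (u x))\<^sup>2) \<partial>haar)"
proof -
  note [measurable] = measurable_left_shift_pair[OF assms]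
  define C where "C = (\<integral>z. \<phi> z \<partial>haar)"
  have C0: "0 \<le> C" unfolding C_def by (intro integral_nonneg_AE AE_I2 majorant_nonneg)
  have C: "(\<integral>\<^sup>+z. ennreal (\<phi> z) \<partial>haar) = ennreal C"
    unfolding C_def
    by (intro nn_integral_eq_integral majorant_integrable AE_I2 majorant_nonneg)
  have pw: "(\<integral>\<^sup>+z. ennreal (\<phi> z * cmod (u (- z + q))) \<partial>haar)\<^sup>2
      \<le> ennreal C * (\<integral>\<^sup>+z. ennreal (\<phi> z) * ennreal ((cmod (u (- z + q)))\<^sup>2) \<partial>haar)" for q
  proof -
    \<comment> \<open>Cauchy-Schwarz for \<open>\<phi> \<bar>u\<bar> = \<surd>\<phi> \<cdot> (\<surd>\<phi> \<bar>u\<bar>)\<close>, so that only \<open>\<phi> \<in> L\<^sup>1\<close> is needed\<close>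
    have "(\<integral>\<^sup>+z. ennreal (\<phi> z * cmod (u (- z + q))) \<partial>haar)
      = (\<integral>\<^sup>+z. ennreal (sqrt (\<phi> z)) * ennreal (sqrt (\<phi> z) * cmod (u (- z + q))) \<partial>haar)"
      by (intro nn_integral_cong)
        (simp add: ennreal_mult[symmetric] majorant_nonneg mult.assoc[symmetric])
    also have "\<dots>\<^sup>2 \<le> (\<integral>\<^sup>+z. (ennreal (sqrt (\<phi> z)))\<^sup>2 \<partial>haar) *
        (\<integral>\<^sup>+z. (ennreal (sqrt (\<phi> z) * cmod (u (- z + q))))\<^sup>2 \<partial>haar)"
      by (intro Cauchy_Schwarz_nn_integral) measurable
    also have "(\<integral>\<^sup>+z. (ennreal (sqrt (\<phi> z)))\<^sup>2 \<partial>haar) = ennreal C"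
      unfolding C[symmetric]
      by (intro nn_integral_cong) (simp add: ennreal_power majorant_nonneg)
    also have "(\<integral>\<^sup>+z. (ennreal (sqrt (\<phi> z) * cmod (u (- z + q))))\<^sup>2 \<partial>haar)
        = (\<integral>\<^sup>+z. ennreal (\<phi> z) * ennreal ((cmod (u (- z + q)))\<^sup>2) \<partial>haar)"
      by (intro nn_integral_cong)
        (simp add: ennreal_power majorant_nonneg power_mult_distrib ennreal_mult[symmetric])
    finally show ?thesis .
  qed
  have "(\<integral>\<^sup>+q. (\<integral>\<^sup>+z. ennreal (\<phi> z * cmod (u (- z + q))) \<partial>haar)\<^sup>2 \<partial>haar)
     \<le> (\<integral>\<^sup>+q. ennreal C * (\<integral>\<^sup>+z. ennreal (\<phi> z) * ennreal ((cmod (u (- z + q)))\<^sup>2) \<partial>haar) \<partial>haar)"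
    by (intro nn_integral_mono pw)
  also have "\<dots> = ennreal C * (\<integral>\<^sup>+q. \<integral>\<^sup>+z. ennreal (\<phi> z) * ennreal ((cmod (u (- z + q)))\<^sup>2) \<partial>haar \<partial>haar)"
    by (intro nn_integral_cmult) measurable
  \<comment> \<open>With \<open>q\<close> as the inner variable, left invariance removes the shift
    by \<open>- z\<close>, and the double integral factorizes.\<close>
  also have "(\<integral>\<^sup>+q. \<integral>\<^sup>+z. ennreal (\<phi> z) * ennreal ((cmod (u (- z + q)))\<^sup>2) \<partial>haar \<partial>haar)
      = (\<integral>\<^sup>+z. \<integral>\<^sup>+q. ennreal (\<phi> z) * ennreal ((cmod (u (- z + q)))\<^sup>2) \<partial>haar \<partial>haar)"
    by (intro haar_pair.Fubini'[symmetric]) measurable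
  also have "\<dots> = (\<integral>\<^sup>+z. ennreal (\<phi> z) * (\<integral>\<^sup>+x. ennreal ((cmod (u x))\<^sup>2) \<partial>haar) \<partial>haar)"
  proof (intro nn_integral_cong)
    fix z
    have "(\<integral>\<^sup>+q. ennreal (\<phi> z) * ennreal ((cmod (u (- z + q)))\<^sup>2) \<partial>haar)
        = ennreal (\<phi> z) * (\<integral>\<^sup>+q. ennreal ((cmod (u (- z + q)))\<^sup>2) \<partial>haar)"
      by (intro nn_integral_cmult) measurable
    also have "(\<integral>\<^sup>+q. ennreal ((cmod (u (- z + q)))\<^sup>2) \<partial>haar) = (\<integral>\<^sup>+x. ennreal ((cmod (u x))\<^sup>2) \<partial>haar)"
      by (intro nn_integral_haar_shift) measurable
    finally show "(\<integral>\<^sup>+q. ennreal (\<phi> z) * ennreal ((cmod (u (- z + q)))\<^sup>2) \<partial>haar)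
        = ennreal (\<phi> z) * (\<integral>\<^sup>+x. ennreal ((cmod (u x))\<^sup>2) \<partial>haar)" .
  qed
  also have "\<dots> = ennreal C * (\<integral>\<^sup>+x. ennreal ((cmod (u x))\<^sup>2) \<partial>haar)"
    unfolding C[symmetric] by (intro nn_integral_multc) measurable
  finally show ?thesis
    unfolding C_def[symmetric]
    by (simp add: ennreal_mult'' C0 power2_eq_square mult.assoc ennreal_mult[OF C0 C0])
qed

text \<open>Holds at every \<open>q\<close>: without integrability the left side is the norm of the
  default value 0.\<close>

lemma kernel_op_norm_le:
  "ennreal (cmod (kernel_op u q)) \<le> (\<integral>\<^sup>+z. ennreal (\<phi> z * cmod (u (- z + q))) \<partial>haar)"
proof -
  have "ennreal (cmod (kernel_op u q)) \<le> (\<integral>\<^sup>+z. ennreal (cmod (k q z * u (- z + q))) \<partial>haar)"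
    unfolding kernel_op_def
    by (cases "integrable haar (\<lambda>z. k q z * u (- z + q))")
      (auto intro: integral_norm_bound_ennreal simp: not_integrable_integral_eq)
  also have "\<dots> \<le> (\<integral>\<^sup>+z. ennreal (\<phi> z * cmod (u (- z + q))) \<partial>haar)"
    by (intro nn_integral_mono ennreal_leI) (simp add: norm_mult mult_right_mono kernel_bound)
  finally show ?thesis .
qed

text \<open>The operator norm is at most the L1 norm of \<open>\<phi>\<close>: pointwise domination
  followed by Young's inequality.\<close>

lemma kernel_op_square_integrable:
  assumes u: "square_integrable u"
  shows "square_integrable (kernel_op u)"
    and "(\<integral>q. (cmod (kernel_op u q))\<^sup>2 \<partial>haar) \<le> (\<integral>z. \<phi> z \<partial>haar)\<^sup>2 * (\<integral>x. (cmod (u x))\<^sup>2 \<partial>haar)"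
proof -
  have [measurable]: "u \<in> borel_measurable haar" and i: "integrable haar (\<lambda>x. (cmod (u x))\<^sup>2)"
    using u by (auto simp: square_integrable_def)
  note [measurable] = kernel_op_measurable[of u]
  have "(\<integral>\<^sup>+q. ennreal ((cmod (kernel_op u q))\<^sup>2) \<partial>haar)
      \<le> (\<integral>\<^sup>+q. (\<integral>\<^sup>+z. ennreal (\<phi> z * cmod (u (- z + q))) \<partial>haar)\<^sup>2 \<partial>haar)"
    by (intro nn_integral_mono)
      (metis ennreal_power kernel_op_norm_le norm_ge_zero power_mono zero_le)
  also have "\<dots> \<le> ennreal ((\<integral>z. \<phi> z \<partial>haar)\<^sup>2) * (\<integral>\<^sup>+x. ennreal ((cmod (u x))\<^sup>2) \<partial>haar)"
    by (rule nn_integral_majorant_sq) measurable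
  also have "(\<integral>\<^sup>+x. ennreal ((cmod (u x))\<^sup>2) \<partial>haar) = ennreal (\<integral>x. (cmod (u x))\<^sup>2 \<partial>haar)"
    by (intro nn_integral_eq_integral i) auto
  finally have le: "(\<integral>\<^sup>+q. ennreal ((cmod (kernel_op u q))\<^sup>2) \<partial>haar)
      \<le> ennreal ((\<integral>z. \<phi> z \<partial>haar)\<^sup>2 * (\<integral>x. (cmod (u x))\<^sup>2 \<partial>haar))"
    by (simp add: ennreal_mult[symmetric])
  have int: "integrable haar (\<lambda>q. (cmod (kernel_op u q))\<^sup>2)"
    using le by (intro integrableI_bounded) (auto intro: le_less_trans)
  then show "square_integrable (kernel_op u)"
    by (simp add: square_integrable_def)
  have "(\<integral>\<^sup>+q. ennreal ((cmod (kernel_op u q))\<^sup>2) \<partial>haar) = ennreal (\<integral>q. (cmod (kernel_op u q))\<^sup>2 \<partial>haar)"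
    by (intro nn_integral_eq_integral int) auto
  with le show "(\<integral>q. (cmod (kernel_op u q))\<^sup>2 \<partial>haar) \<le> (\<integral>z. \<phi> z \<partial>haar)\<^sup>2 * (\<integral>x. (cmod (u x))\<^sup>2 \<partial>haar)"
    by (simp add: ennreal_le_iff)
qed

text \<open>A nonnegative function with finite integral is finite almost everywhere; here it is the
  square of the dominating integral \<open>?h\<close>.\<close>

lemma kernel_integrand_integrable:
  assumes u: "square_integrable u"
  shows "AE q in haar. integrable haar (\<lambda>z. k q z * u (- z + q))"
proof -
  have um: "u \<in> borel_measurable haar" and i: "integrable haar (\<lambda>x. (cmod (u x))\<^sup>2)"
    using u by (auto simp: square_integrable_def)
  note [measurable] = um measurable_left_shift_pair[OF um]
  let ?h = "\<lambda>q. \<integral>\<^sup>+z. ennreal (\<phi> z * cmod (u (- z + q))) \<partial>haar"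
  have "(\<integral>\<^sup>+q. (?h q)\<^sup>2 \<partial>haar) \<noteq> \<infinity>"
    using nn_integral_majorant_sq[OF um] nn_integral_eq_integral[OF i]
    by (auto simp: ennreal_mult[symmetric] top_unique)
  then have "AE q in haar. (?h q)\<^sup>2 \<noteq> \<infinity>"
    by (intro nn_integral_PInf_AE) measurable
  then show ?thesis
  proof eventually_elim
    case (elim q)
    have "(\<integral>\<^sup>+z. ennreal (cmod (k q z * u (- z + q))) \<partial>haar) \<le> ?h q"
      by (intro nn_integral_mono ennreal_leI) (simp add: norm_mult mult_right_mono kernel_bound)
    moreover have "?h q < \<infinity>" using elim by (auto simp: less_top power2_eq_square ennreal_mult_eq_top_iff)
    ultimately have "(\<integral>\<^sup>+z. ennreal (cmod (k q z * u (- z + q))) \<partial>haar) < \<infinity>"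
      by (rule le_less_trans)
    moreover have "(\<lambda>z. k q z * u (- z + q)) \<in> borel_measurable haar" by measurable
    ultimately show ?case by (intro integrableI_bounded)
  qed
qed

text \<open>Only almost everywhere, because the default value 0 can break additivity where one of
  the two integrands fails to be integrable.\<close>

lemma kernel_op_add_AE:
  assumes "square_integrable u" "square_integrable v"
  shows "AE q in haar. kernel_op (\<lambda>x. u x + v x) q = kernel_op u q + kernel_op v q"
  using kernel_integrand_integrable[OF assms(1)] kernel_integrand_integrable[OF assms(2)]
  by eventually_elim (simp add: kernel_op_def distrib_left)

text \<open>Unlike additivity this holds at every \<open>q\<close>: a nonzero \<open>c\<close> does
  not affect integrability, and for \<open>c = 0\<close> both sides vanish.\<close>

lemma kernel_op_scale: "kernel_op (\<lambda>x. c * u x) q = c * kernel_op u q"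
  unfolding kernel_op_def by (simp add: mult.left_commute[of _ c])

end


section \<open>Operators on classes modulo null sets; multiplication operators\<close>

lemma abs_rep_L2: "abs_L2 (rep_L2 u) = u"
  by (rule Quotient3_abs_rep[OF Quotient3_L2])

lemma square_integrable_rep_L2: "square_integrable (rep_L2 u)"
  using Quotient3_rep_reflp[OF Quotient3_L2, of u] by (simp add: L2_rel_def)

lemma L2_rel_refl_iff: "L2_rel u u \<longleftrightarrow> square_integrable u"
  by (auto simp: L2_rel_def)

lemma rep_abs_L2_AE: "square_integrable u \<Longrightarrow> AE x in haar. rep_L2 (abs_L2 u) x = u x"
  using Quotient3_rep_abs[OF Quotient3_L2, of u] by (simp add: L2_rel_def)

lemma abs_L2_eqI:
  "square_integrable u \<Longrightarrow> square_integrable v \<Longrightarrow> AE x in haar. u x = v x \<Longrightarrow> abs_L2 u = abs_L2 v"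
  using Quotient3_rel[OF Quotient3_L2, of u v] by (simp add: L2_rel_def)

lemma cinner_abs_L2:
  "square_integrable u \<Longrightarrow> square_integrable v \<Longrightarrow>
    cinner_L2 (abs_L2 u) (abs_L2 v) = (\<integral>x. u x * cnj (v x) \<partial>haar)"
  by (simp add: cinner_L2.abs_eq L2_rel_refl_iff)

lemma plus_abs_L2:
  "square_integrable u \<Longrightarrow> square_integrable v \<Longrightarrow> abs_L2 u + abs_L2 v = abs_L2 (\<lambda>x. u x + v x)"
  by (simp add: plus_L2.abs_eq L2_rel_refl_iff)

lemma scaleR_abs_L2:
  "square_integrable u \<Longrightarrow> r *\<^sub>R abs_L2 u = abs_L2 (\<lambda>x. complex_of_real r * u x)"
  by (simp add: scaleR_L2.abs_eq L2_rel_refl_iff)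

lemma norm_abs_L2:
  assumes "square_integrable u"
  shows "norm (abs_L2 u) = sqrt (\<integral>x. (cmod (u x))\<^sup>2 \<partial>haar)"
proof -
  have "(\<integral>x. u x * cnj (u x) \<partial>haar) = of_real (\<integral>x. (cmod (u x))\<^sup>2 \<partial>haar)"
    by (simp add: complex_norm_square[symmetric] del: of_real_power)
  then show ?thesis
    by (simp add: norm_eq_sqrt_inner inner_L2_def cinner_abs_L2[OF assms assms])
qed

text \<open>Operators given through \<open>Blinfun\<close> and representatives can be evaluated only
  once they are known to be bounded and linear. This criterion asks for the properties on functions,
  up to null sets, and serves both integral and multiplication operators.\<close>

lemma bounded_linear_abs_L2:
  fixes F :: "('g::lcsc_group \<Rightarrow> complex) \<Rightarrow> 'g \<Rightarrow> complex"
  assumes sq: "\<And>u. square_integrable u \<Longrightarrow> square_integrable (F u)"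
    and cong: "\<And>u v. square_integrable u \<Longrightarrow> square_integrable v \<Longrightarrow>
      AE x in haar. u x = v x \<Longrightarrow> AE x in haar. F u x = F v x"
    and add: "\<And>u v. square_integrable u \<Longrightarrow> square_integrable v \<Longrightarrow>
      AE x in haar. F (\<lambda>x. u x + v x) x = F u x + F v x"
    and scale: "\<And>c u. square_integrable u \<Longrightarrow> AE x in haar. F (\<lambda>x. c * u x) x = c * F u x"
    and bound: "\<And>u. square_integrable u \<Longrightarrow>
      (\<integral>x. (cmod (F u x))\<^sup>2 \<partial>haar) \<le> C\<^sup>2 * (\<integral>x. (cmod (u x))\<^sup>2 \<partial>haar)"
  shows "bounded_linear (\<lambda>u. abs_L2 (F (rep_L2 u)))"
proof -
  \<comment> \<open>The representative chosen for the class of \<open>u\<close> may differ from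
    \<open>u\<close> on a null set, which \<open>cong\<close> absorbs.\<close>
  have lift: "abs_L2 (F (rep_L2 (abs_L2 u))) = abs_L2 (F u)" if "square_integrable u" for u
    using that by (intro abs_L2_eqI sq cong rep_abs_L2_AE square_integrable_rep_L2)
  have add': "abs_L2 (F (rep_L2 (abs_L2 u + abs_L2 v))) = abs_L2 (F u) + abs_L2 (F v)"
    if "square_integrable u" "square_integrable v" for u v
    unfolding plus_abs_L2[OF that] plus_abs_L2[OF sq sq, OF that] lift[OF square_integrable_add[OF that]]
    by (intro abs_L2_eqI add sq square_integrable_add that)
  have scale': "abs_L2 (F (rep_L2 (r *\<^sub>R abs_L2 u))) = r *\<^sub>R abs_L2 (F u)"
    if "square_integrable u" for u r
    unfolding scaleR_abs_L2[OF that] scaleR_abs_L2[OF sq, OF that]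
      lift[OF square_integrable_scaleC[OF that]]
    by (intro abs_L2_eqI scale sq square_integrable_scaleC that)
  \<comment> \<open>The absolute value appears because the square root of \<open>C\<^sup>2\<close>
    is \<open>\<bar>C\<bar>\<close>.\<close>
  have norm': "norm (abs_L2 (F u)) \<le> norm (abs_L2 u) * \<bar>C\<bar>" if "square_integrable u" for u
    using real_sqrt_le_mono[OF bound[OF that]]
    by (simp add: norm_abs_L2 that sq real_sqrt_mult mult.commute)
  show ?thesis
  proof (rule bounded_linear_intro)
    fix u v :: "'g L2" and r :: real
    show "abs_L2 (F (rep_L2 (u + v))) = abs_L2 (F (rep_L2 u)) + abs_L2 (F (rep_L2 v))"
      using add'[OF square_integrable_rep_L2[of u] square_integrable_rep_L2[of v]]
      by (simp add: abs_rep_L2)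
    show "abs_L2 (F (rep_L2 (r *\<^sub>R u))) = r *\<^sub>R abs_L2 (F (rep_L2 u))"
      using scale'[OF square_integrable_rep_L2[of u]] by (simp add: abs_rep_L2)
    show "norm (abs_L2 (F (rep_L2 u))) \<le> norm u * \<bar>C\<bar>"
      using norm'[OF square_integrable_rep_L2[of u]] by (simp add: abs_rep_L2)
  qed
qed

lemma (in dominated_kernel) bounded_linear_kernel_op:
  "bounded_linear (\<lambda>u. abs_L2 (kernel_op (rep_L2 u)))"
proof (rule bounded_linear_abs_L2[where C = "\<integral>z. \<phi> z \<partial>haar"])
  show "AE x in haar. kernel_op u x = kernel_op v x"
    if "square_integrable u" "square_integrable v" "AE x in haar. u x = v x" for u v
    using that by (intro kernel_op_cong_AE) (simp_all add: square_integrable_def)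
qed (simp_all add: kernel_op_square_integrable kernel_op_add_AE kernel_op_scale)

lemma square_integrable_mult_unimodular:
  assumes a: "a \<in> borel_measurable haar" "\<And>q. cmod (a q) = 1" and u: "square_integrable u"
  shows "square_integrable (\<lambda>q. a q * u q)"
  using u borel_measurable_times[OF a(1), of u]
  by (simp add: square_integrable_def norm_mult a(2))

lemma mult_op_apply:
  fixes a :: "'g::lcsc_group \<Rightarrow> complex"
  assumes a: "a \<in> borel_measurable haar" "\<And>q. cmod (a q) = 1"
  shows "blinfun_apply (mult_op a) u = abs_L2 (\<lambda>q. a q * rep_L2 u q)"
proof -
  have "bounded_linear (\<lambda>u. abs_L2 (\<lambda>q. a q * rep_L2 u q))"
  proof (rule bounded_linear_abs_L2[where F = "\<lambda>u q. a q * u q" and C = 1])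
    show "square_integrable (\<lambda>q. a q * u q)" if "square_integrable u" for u
      using that by (rule square_integrable_mult_unimodular[OF a])
  qed (auto simp: a(2) norm_mult algebra_simps)
  then show ?thesis by (simp add: mult_op_def bounded_linear_Blinfun_apply)
qed

lemma mult_op_apply_abs_L2:
  fixes a :: "'g::lcsc_group \<Rightarrow> complex"
  assumes a: "a \<in> borel_measurable haar" "\<And>q. cmod (a q) = 1" and u: "square_integrable u"
  shows "blinfun_apply (mult_op a) (abs_L2 u) = abs_L2 (\<lambda>q. a q * u q)"
  unfolding mult_op_apply[OF a] using rep_abs_L2_AE[OF u]
  by (intro abs_L2_eqI square_integrable_mult_unimodular a u square_integrable_rep_L2) auto

text \<open>The real part of the complex inner product already separates vectors. This gives the
  uniqueness of adjoints.\<close>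

lemma L2_blinfun_eqI_cinner:
  assumes "\<And>u v. cinner_L2 (blinfun_apply S u) v = cinner_L2 (blinfun_apply T u) v"
  shows "S = T"
proof (rule blinfun_eqI)
  fix u
  have "inner (blinfun_apply S u) v = inner (blinfun_apply T u) v" for v
    by (simp add: inner_L2_def assms)
  then show "blinfun_apply S u = blinfun_apply T u"
    using vector_eq_rdot by blast
qed

lemma borel_measurable_cnj:
  assumes "a \<in> borel_measurable M"
  shows "(\<lambda>x. cnj (a x)) \<in> borel_measurable M"
  by (rule measurable_compose[OF assms])
    (intro borel_measurable_continuous_onI continuous_intros)

lemma adj_mult_op:
  fixes a :: "'g::lcsc_group \<Rightarrow> complex"
  assumes a: "a \<in> borel_measurable haar" "\<And>q. cmod (a q) = 1"
  shows "adj_L2 (mult_op a) = mult_op (\<lambda>q. cnj (a q))"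
proof -
  have a': "(\<lambda>q. cnj (a q)) \<in> borel_measurable haar" "\<And>q. cmod (cnj (a q)) = 1"
    using a by (auto intro: borel_measurable_cnj)
  have *: "cinner_L2 (mult_op (\<lambda>q. cnj (a q)) u) v = cinner_L2 u (mult_op a v)" for u v
  proof -
    have "cinner_L2 (mult_op (\<lambda>q. cnj (a q)) u) v
        = cinner_L2 (abs_L2 (\<lambda>q. cnj (a q) * rep_L2 u q)) (abs_L2 (rep_L2 v))"
      unfolding mult_op_apply[OF a'] by (simp add: abs_rep_L2)
    also have "\<dots> = cinner_L2 (abs_L2 (rep_L2 u)) (abs_L2 (\<lambda>q. a q * rep_L2 v q))"
      by (simp add: cinner_abs_L2 square_integrable_mult_unimodular[OF a] square_integrable_rep_L2
          square_integrable_mult_unimodular[OF a'] mult_ac)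
    finally show ?thesis
      unfolding mult_op_apply[OF a] by (simp add: abs_rep_L2)
  qed
  show ?thesis
    unfolding adj_L2_def
    \<comment> \<open>The adjoint is a definite description: \<open>*\<close> shows that the
      candidate qualifies, and \<open>L2_blinfun_eqI_cinner\<close> excludes any other.\<close>
    by (rule the_equality) (auto intro!: L2_blinfun_eqI_cinner simp: *)
qed

text \<open>Used in both orders with \<open>a\<close> and its conjugate, which yields the unitarity
  of multiplication by \<open>a\<close>.\<close>

lemma mult_op_inverse:
  fixes a b :: "'g::lcsc_group \<Rightarrow> complex"
  assumes a: "a \<in> borel_measurable haar" "\<And>q. cmod (a q) = 1"
    and b: "b \<in> borel_measurable haar" "\<And>q. cmod (b q) = 1"
    and ab: "\<And>q. a q * b q = 1"
  shows "mult_op a o\<^sub>L mult_op b = id_blinfun"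
  by (rule blinfun_eqI)
    (simp add: mult_op_apply[OF b] mult_op_apply_abs_L2[OF a] square_integrable_rep_L2
      square_integrable_mult_unimodular[OF b] mult.assoc[symmetric] ab abs_rep_L2)

section \<open>The Schroedinger operators of L1 functions\<close>

text \<open>Joint measurability is inherited from the approximating simple functions: each takes
  finitely many values, and each value is a continuous function evaluated at a continuous
  shift.\<close>

lemma bochner_L1_measurable_pair:
  assumes \<Phi>: "\<Phi> \<in> bochner_L1 A" and \<tau>: "continuous_on UNIV (\<tau> :: 'g::lcsc_group \<Rightarrow> 'g)"
  shows "(\<lambda>(q, z). apply_bcontfun (\<Phi> z) (- \<tau> z + q)) \<in> borel_measurable (haar \<Otimes>\<^sub>M haar)"
proof -
  obtain s where s: "\<And>n. simple_function haar (s n)" "\<And>x. (\<lambda>n. s n x) \<longlonglongrightarrow> \<Phi> x"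
    using \<Phi> by (auto simp: bochner_L1_def)
  have "(\<lambda>p. apply_bcontfun (s n (snd p)) (- \<tau> (snd p) + fst p))
      \<in> borel_measurable (haar \<Otimes>\<^sub>M haar)" for n
  \<comment> \<open>Splits the pairs according to the value \<open>c\<close> of \<open>s n\<close>,
    so that only a fixed function \<open>c\<close> has to be evaluated.\<close>
  proof (rule measurable_compose_countable'[where I = "range (s n)"])
    have "continuous_on UNIV (\<lambda>p::'g \<times> 'g. \<tau> (snd p))"
      by (rule continuous_on_compose2[OF \<tau> continuous_on_snd[OF continuous_on_id]]) simp
    then have shift: "continuous_on UNIV (\<lambda>p::'g \<times> 'g. - \<tau> (snd p) + fst p)"
      by (intro continuous_on_add continuous_on_minus continuous_on_fst continuous_on_id)
    show "(\<lambda>p. apply_bcontfun c (- \<tau> (snd p) + fst p)) \<in> borel_measurable (haar \<Otimes>\<^sub>M haar)"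
      for c :: "'g \<Rightarrow>\<^sub>C complex"
      by (rule haar_pair_measurable_continuous,
          rule continuous_on_compose2[OF continuous_on_apply_bcontfun[of UNIV] shift]) simp
    have "finite (range (s n))" using s(1)[of n] by (simp add: simple_function_def)
    then show "countable (range (s n))" by (rule countable_finite)
    have "s n \<in> haar \<rightarrow>\<^sub>M count_space (range (s n))"
      using s(1)[of n] by (auto simp: simple_function_def measurable_count_space_eq2)
    then show "(\<lambda>p. s n (snd p)) \<in> (haar :: 'g measure) \<Otimes>\<^sub>M haar \<rightarrow>\<^sub>M count_space (range (s n))"
      by (rule measurable_compose[OF measurable_snd])
  qed
  \<comment> \<open>Evaluation at a point is 1-Lipschitz for the supremum norm.\<close>
  moreover have "(\<lambda>n. apply_bcontfun (s n z) q) \<longlonglongrightarrow> apply_bcontfun (\<Phi> z) q" for z q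
  proof (rule metric_tendsto_imp_tendsto[OF s(2)[of z]])
    show "\<forall>\<^sub>F n in sequentially. dist (apply_bcontfun (s n z) q) (apply_bcontfun (\<Phi> z) q)
        \<le> dist (s n z) (\<Phi> z)"
      by (intro always_eventually allI dist_bounded)
  qed
  ultimately show ?thesis
    unfolding split_beta' by (rule borel_measurable_LIMSEQ_metric)
qed

lemma dominated_kernel_Sch:
  assumes \<Phi>: "\<Phi> \<in> bochner_L1 A" and \<tau>: "continuous_on UNIV (\<tau> :: 'g::lcsc_group \<Rightarrow> 'g)"
    and \<beta>: "pseudo_trivialization \<gamma> \<beta>"
  shows "dominated_kernel (\<lambda>q z. \<beta> q z * apply_bcontfun (\<Phi> z) (- \<tau> z + q)) (\<lambda>z. norm (\<Phi> z))"
proof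
  have "(\<lambda>(q, z). \<beta> q z) \<in> borel_measurable (haar \<Otimes>\<^sub>M haar)"
    using \<beta> by (intro haar_pair_measurable_continuous) (simp add: pseudo_trivialization_def)
  from borel_measurable_times[OF this bochner_L1_measurable_pair[OF \<Phi> \<tau>]]
  show "(\<lambda>(q, z). \<beta> q z * apply_bcontfun (\<Phi> z) (- \<tau> z + q)) \<in> borel_measurable (haar \<Otimes>\<^sub>M haar)"
    by (simp add: split_beta')
  show "cmod (\<beta> q z * apply_bcontfun (\<Phi> z) (- \<tau> z + q)) \<le> norm (\<Phi> z)" for q z
    using \<beta> by (simp add: norm_mult pseudo_trivialization_def norm_bounded)
  show "integrable haar (\<lambda>z. norm (\<Phi> z))" using \<Phi> by (simp add: bochner_L1_def)
qed

text \<open>The factor \<open>a (- z + q)\<close> of the coboundary joins \<open>u (- z + q)\<close>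
  and turns \<open>u\<close> into the product of \<open>a\<close> and \<open>u\<close>; the factor
  \<open>inverse (a q)\<close> is constant in \<open>z\<close> and leaves the integral as
  \<open>cnj (a q)\<close>.\<close>

lemma Sch_L1_coboundary:
  fixes a :: "'g::lcsc_group \<Rightarrow> complex"
  assumes \<Phi>: "\<Phi> \<in> bochner_L1 A" and \<tau>: "continuous_on UNIV \<tau>"
    and \<beta>: "pseudo_trivialization \<gamma> \<beta>" and \<beta>': "pseudo_trivialization \<gamma>' \<beta>'"
    and a: "a \<in> borel_measurable haar" "\<And>q. cmod (a q) = 1"
    and eq: "\<And>q x. \<beta>' q x = coboundary0 a q x * \<beta> q x"
  shows "Sch_L1 \<tau> \<beta>' \<Phi> = mult_op (\<lambda>q. cnj (a q)) o\<^sub>L Sch_L1 \<tau> \<beta> \<Phi> o\<^sub>L mult_op a"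
proof (rule blinfun_eqI)
  fix u :: "'g L2"
  interpret K: dominated_kernel "\<lambda>q z. \<beta> q z * apply_bcontfun (\<Phi> z) (- \<tau> z + q)" "\<lambda>z. norm (\<Phi> z)"
    by (rule dominated_kernel_Sch[OF \<Phi> \<tau> \<beta>])
  interpret K': dominated_kernel "\<lambda>q z. \<beta>' q z * apply_bcontfun (\<Phi> z) (- \<tau> z + q)" "\<lambda>z. norm (\<Phi> z)"
    by (rule dominated_kernel_Sch[OF \<Phi> \<tau> \<beta>'])
  have Sch: "blinfun_apply (Sch_L1 \<tau> \<beta> \<Phi>) u = abs_L2 (K.kernel_op (rep_L2 u))" for u
    using bounded_linear_Blinfun_apply[OF K.bounded_linear_kernel_op]
    by (simp add: Sch_L1_def K.kernel_op_def[abs_def])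
  have Sch': "blinfun_apply (Sch_L1 \<tau> \<beta>' \<Phi>) u = abs_L2 (K'.kernel_op (rep_L2 u))" for u
    using bounded_linear_Blinfun_apply[OF K'.bounded_linear_kernel_op]
    by (simp add: Sch_L1_def K'.kernel_op_def[abs_def])
  have a': "(\<lambda>q. cnj (a q)) \<in> borel_measurable haar" "\<And>q. cmod (cnj (a q)) = 1"
    using a by (auto intro: borel_measurable_cnj)
  have inv: "inverse (a q) = cnj (a q)" for q
    using complex_norm_square[of "a q"] a(2)[of q]
    by (intro inverse_unique) simp
  let ?v = "\<lambda>q. a q * rep_L2 u q"
  have sv: "square_integrable ?v"
    by (intro square_integrable_mult_unimodular[OF a] square_integrable_rep_L2)
  \<comment> \<open>Valid at every \<open>q\<close>, since a constant factor leaves the integral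
    even when the integrand is not integrable.\<close>
  have pw: "K'.kernel_op (rep_L2 u) q = cnj (a q) * K.kernel_op ?v q" for q
  proof -
    have "K'.kernel_op (rep_L2 u) q = (\<integral>z. cnj (a q) *
        (\<beta> q z * apply_bcontfun (\<Phi> z) (- \<tau> z + q) * (a (- z + q) * rep_L2 u (- z + q))) \<partial>haar)"
      unfolding K'.kernel_op_def
      by (intro Bochner_Integration.integral_cong refl) (simp only: eq coboundary0_def inv mult_ac)
    then show ?thesis
      unfolding K.kernel_op_def by (simp only: Bochner_Integration.integral_mult_right_zero)
  qed
  \<comment> \<open>Composing operators passes through the class of \<open>?v\<close> and hence
    through another representative of it.\<close>
  have "AE q in haar. K.kernel_op (rep_L2 (abs_L2 ?v)) q = K.kernel_op ?v q"
    using square_integrable_rep_L2 sv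
    by (intro K.kernel_op_cong_AE rep_abs_L2_AE) (auto simp: square_integrable_def)
  then have "blinfun_apply (Sch_L1 \<tau> \<beta> \<Phi>) (abs_L2 ?v) = abs_L2 (K.kernel_op ?v)"
    unfolding Sch by (intro abs_L2_eqI K.kernel_op_square_integrable sv square_integrable_rep_L2)
  then show "blinfun_apply (Sch_L1 \<tau> \<beta>' \<Phi>) u =
      blinfun_apply (mult_op (\<lambda>q. cnj (a q)) o\<^sub>L Sch_L1 \<tau> \<beta> \<Phi> o\<^sub>L mult_op a) u"
    by (simp add: Sch' mult_op_apply[OF a] mult_op_apply_abs_L2[OF a'] pw[abs_def]
        K.kernel_op_square_integrable[OF sv])
qed

section \<open>Passage to the completion\<close>

theorem proposition2p12:
  fixes \<tau> :: "'g::unimodular_group \<Rightarrow> 'g"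
    and A :: "('g \<Rightarrow>\<^sub>C complex) set"
    and \<gamma> :: "'g \<Rightarrow> 'g \<Rightarrow> 'g \<Rightarrow> complex"
    and \<beta> \<beta>' :: "'g \<Rightarrow> 'g \<Rightarrow> complex"
    and a :: "'g \<Rightarrow> complex"
  assumes "continuous_on UNIV \<tau>"
    and "basic_data A \<gamma>" and "compatible A \<gamma>"
    and "pseudo_trivialization \<gamma> \<beta>" and "pseudo_trivialization \<gamma> \<beta>'"
    and "continuous_on UNIV a" and "\<forall>q. cmod (a q) = 1"
    and "\<forall>q x. \<beta>' q x = coboundary0 a q x * \<beta> q x"
  shows "\<forall>F \<in> crossed_product \<tau> A \<gamma>.
           Sch \<tau> \<beta>' F = adj_L2 (mult_op a) o\<^sub>L Sch \<tau> \<beta> F o\<^sub>L mult_op a"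
proof
  fix F assume F: "F \<in> crossed_product \<tau> A \<gamma>"
  have a: "a \<in> borel_measurable haar" "\<And>q. cmod (a q) = 1"
    using borel_measurable_continuous_onI[OF assms(6)] assms(7)
    by (simp_all cong: measurable_cong_sets add: sets_haar)
  have a': "(\<lambda>q. cnj (a q)) \<in> borel_measurable haar" "\<And>q. cmod (cnj (a q)) = 1"
    using a by (auto intro: borel_measurable_cnj)
  have unit: "a q * cnj (a q) = 1" for q
    using complex_norm_square[of "a q"] a(2)[of q] by simp
  \<comment> \<open>\<open>N\<close> is the explicit form of the adjoint of \<open>M\<close>;
    \<open>adj_mult_op\<close> restores the adjoint at the end.\<close>
  define M where "M = mult_op a"
  define N where "N = mult_op (\<lambda>q. cnj (a q))"
  have MN: "M o\<^sub>L N = id_blinfun" and NM: "N o\<^sub>L M = id_blinfun"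
    unfolding M_def N_def using unit
    by (auto intro!: mult_op_inverse a a' simp: mult.commute[of "cnj _"])
  have MN_apply: "blinfun_apply M (blinfun_apply N x) = x" for x
    using arg_cong[OF MN, of "\<lambda>T. blinfun_apply T x"] by simp
  have NM_apply: "blinfun_apply N (blinfun_apply M x) = x" for x
    using arg_cong[OF NM, of "\<lambda>T. blinfun_apply T x"] by simp
  \<comment> \<open>Conjugation by the unitary and conjugation by its inverse undo each
    other.\<close>
  have cancel: "M o\<^sub>L (N o\<^sub>L T o\<^sub>L M) o\<^sub>L N = T" "N o\<^sub>L (M o\<^sub>L T o\<^sub>L N) o\<^sub>L M = T" for T
    by (rule blinfun_eqI, simp add: MN_apply NM_apply)+
  \<comment> \<open>\<open>F\<close> is an equivalence class of Cauchy sequences, so all its members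
    have their terms in \<open>bochner_L1 A\<close>.\<close>
  have L1: "s n \<in> bochner_L1 A" if "s \<in> F" for s n
    using F that unfolding crossed_product_def enveloping_Cauchy_def quotient_def by auto
  have Sch_L1: "Sch_L1 \<tau> \<beta>' (s n) = N o\<^sub>L Sch_L1 \<tau> \<beta> (s n) o\<^sub>L M" if "s \<in> F" for s n
    unfolding M_def N_def
    by (rule Sch_L1_coboundary[OF L1[OF that] assms(1,4,5) a]) (use assms(8) in blast)
  \<comment> \<open>\<open>P\<close> and \<open>P'\<close> are the limit conditions by which
    \<open>Sch\<close> selects its values for \<open>\<beta>\<close> and
    \<open>\<beta>'\<close>.\<close>
  define P where "P = (\<lambda>T. \<forall>s\<in>F. (\<lambda>n. Sch_L1 \<tau> \<beta> (s n)) \<longlonglongrightarrow> T)"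
  define P' where "P' = (\<lambda>T. \<forall>s\<in>F. (\<lambda>n. Sch_L1 \<tau> \<beta>' (s n)) \<longlonglongrightarrow> T)"
  note lim = bounded_bilinear.tendsto[OF bounded_bilinear_blinfun_compose]
  \<comment> \<open>Composition is continuous in operator norm, so limits can be conjugated;
    conjugating back gives the converse.\<close>
  have conj: "P' (N o\<^sub>L T o\<^sub>L M) \<longleftrightarrow> P T" for T
  proof -
    have "(\<lambda>n. N o\<^sub>L Sch_L1 \<tau> \<beta> (s n) o\<^sub>L M) \<longlonglongrightarrow> (N o\<^sub>L T o\<^sub>L M) \<longleftrightarrow>
        (\<lambda>n. Sch_L1 \<tau> \<beta> (s n)) \<longlonglongrightarrow> T" for s
    proof
      assume "(\<lambda>n. N o\<^sub>L Sch_L1 \<tau> \<beta> (s n) o\<^sub>L M) \<longlonglongrightarrow> (N o\<^sub>L T o\<^sub>L M)"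
      from lim[OF lim[OF tendsto_const[of M] this] tendsto_const[of N]]
      show "(\<lambda>n. Sch_L1 \<tau> \<beta> (s n)) \<longlonglongrightarrow> T" by (simp only: cancel)
    qed (intro lim tendsto_const)
    then show ?thesis by (simp add: P_def P'_def Sch_L1)
  qed
  have conj': "P' T \<longleftrightarrow> P (M o\<^sub>L T o\<^sub>L N)" for T
    using conj[of "M o\<^sub>L T o\<^sub>L N"] by (simp only: cancel)
  have "Sch \<tau> \<beta>' F = N o\<^sub>L Sch \<tau> \<beta> F o\<^sub>L M"
  proof (cases "\<exists>!T. P T")
    case True
    then obtain T where T: "P T" "\<And>S. P S \<Longrightarrow> S = T" by blast
    have "P' (N o\<^sub>L T o\<^sub>L M)" using conj T(1) by blast
    moreover have "S = N o\<^sub>L T o\<^sub>L M" if "P' S" for S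
      using T(2) that cancel(2)[of S] unfolding conj' by metis
    ultimately have "\<exists>!T. P' T" and "(THE T. P' T) = N o\<^sub>L T o\<^sub>L M" by blast+
    moreover have "(THE T. P T) = T" using T by blast
    ultimately show ?thesis
      using True by (simp add: Sch_def P_def P'_def)
  next
    case False
    \<comment> \<open>A unique limit for \<open>\<beta>'\<close> would give one for
      \<open>\<beta>\<close> by the inverse conjugation. Hence both values of \<open>Sch\<close> are
      0, and conjugation preserves 0.\<close>
    moreover have "\<not> (\<exists>!T. P' T)"
    proof
      assume "\<exists>!T. P' T"
      then obtain T where "P' T" "\<And>S. P' S \<Longrightarrow> S = T" by blast
      then have "P (M o\<^sub>L T o\<^sub>L N)" "\<And>S. P S \<Longrightarrow> S = M o\<^sub>L T o\<^sub>L N"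
        using conj conj' cancel(1) by metis+
      then show False using False by blast
    qed
    ultimately show ?thesis
      by (simp add: Sch_def P_def P'_def)
  qed
  then show "Sch \<tau> \<beta>' F = adj_L2 (mult_op a) o\<^sub>L Sch \<tau> \<beta> F o\<^sub>L mult_op a"
    by (simp only: adj_mult_op[OF a] M_def N_def)
qed

end
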